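(* For every $d$, $D$, and $k$ there exists $N=N(d,D,k)$, for which an explicit bound can be given, such that for every $d$-dimensional $k$-ary semialgebraic predicate $\Phi$ that is a conjunction of polynomial equations and inequalities and in which all the polynomials have degree at most $D$, the following two conditions are equivalent: (i) there exist $N$-point sets $A_1,\ldots,A_k\subseteq\mathbb{R}^d$ such that $\Phi$ holds everywhere on $A_1\times\cdots\times A_k$; (ii) there exist infinite sets $X_1,\ldots,X_k\subseteq\mathbb{R}^d$ such that $\Phi$ holds everywhere on $X_1\times\cdots\times X_k$. Moreover, for an arbitrary $d$-dimensional $k$-ary semialgebraic predicate $\Phi$ the same equivalence holds with some $N$ depending on $d$, $D$, $k$, and also on the length of $\Phi$ (again in a way that can be made explicit).
   Context: A $d$-dimensional $k$-ary semialgebraic predicate $\Phi(\mathbf{x}_1,\ldots,\mathbf{x}_k)$, $\mathbf{x}_i\in\mathbb{R}^d$, is a Boolean combination of polynomial equations and inequalities (polynomials with rational coefficients) in the $dk$ coordinates of the points. For sets $A_1,\ldots,A_k\subseteq\mathbb{R}^d$, $\Phi$ holds everywhere on $A_1\times\cdots\times A_k$ if $\Phi(\mathbf{a}_1,\ldots,\mathbf{a}_k)$ holds for every choice of $\mathbf{a}_1\in A_1,\ldots,\mathbf{a}_k\in A_k$.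
   Formalization: In the first part "inequalities" means strict inequalities or p≠0; with weak ones it is false: for d=k=1, D=2, x(n-x)≥0 and (x-i)(x-i-1)≥0 (0≤i<n) have exactly n+1 solutions. "Explicit bound" is rendered as N being primitive recursive. *)

theory Defs
  imports "HOL-Analysis.Analysis" "HOL-Library.Poly_Mapping"
begin

text \<open>
  Points of \<open>\<real>\<^sup>d\<close> are the elements of the topspace of \<^term>\<open>Euclidean_space d\<close>. A \<open>k\<close>-tuple of points is a
  function \<open>a\<close> such that \<open>a i j\<close> is the \<open>j\<close>-th coordinate of the \<open>i\<close>-th point, for \<open>i < k\<close> and \<open>j < d\<close>.
  Polynomials in these coordinates are finitely supported maps from monomials to rational coefficients;
  the variable \<open>(i, j)\<close> stands for \<open>a i j\<close>.
\<close>

type_synonym point = "nat \<Rightarrow> real"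
type_synonym rat_mpoly = "((nat \<times> nat) \<Rightarrow>\<^sub>0 nat) \<Rightarrow>\<^sub>0 rat"

definition mpoly_eval :: "rat_mpoly \<Rightarrow> (nat \<Rightarrow> point) \<Rightarrow> real" where
  "mpoly_eval p a =
    (\<Sum>m\<in>Poly_Mapping.keys p. of_rat (Poly_Mapping.lookup p m) *
      (\<Prod>v\<in>Poly_Mapping.keys m. a (fst v) (snd v) ^ Poly_Mapping.lookup m v))"

definition mpoly_vars :: "rat_mpoly \<Rightarrow> (nat \<times> nat) set" where
  "mpoly_vars p = (\<Union>m\<in>Poly_Mapping.keys p. Poly_Mapping.keys m)"

text \<open>The total degree; the zero polynomial gets degree \<open>0\<close>.\<close>

definition mpoly_degree :: "rat_mpoly \<Rightarrow> nat" where
  "mpoly_degree p =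
    Max (insert 0 ((\<lambda>m. \<Sum>v\<in>Poly_Mapping.keys m. Poly_Mapping.lookup m v) ` Poly_Mapping.keys p))"

datatype sign_rel = EqZ | NeqZ | LessZ | GreaterZ | LeZ | GeZ

fun sign_holds :: "sign_rel \<Rightarrow> real \<Rightarrow> bool" where
  "sign_holds EqZ x \<longleftrightarrow> x = 0"
| "sign_holds NeqZ x \<longleftrightarrow> x \<noteq> 0"
| "sign_holds LessZ x \<longleftrightarrow> x < 0"
| "sign_holds GreaterZ x \<longleftrightarrow> x > 0"
| "sign_holds LeZ x \<longleftrightarrow> x \<le> 0"
| "sign_holds GeZ x \<longleftrightarrow> x \<ge> 0"

datatype sa_formula =
    Atom sign_rel rat_mpoly
  | Neg sa_formula
  | Conj sa_formula sa_formula
  | Disj sa_formula sa_formula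

fun sat :: "sa_formula \<Rightarrow> (nat \<Rightarrow> point) \<Rightarrow> bool" where
  "sat (Atom r p) a \<longleftrightarrow> sign_holds r (mpoly_eval p a)"
| "sat (Neg \<Phi>) a \<longleftrightarrow> \<not> sat \<Phi> a"
| "sat (Conj \<Phi> \<Psi>) a \<longleftrightarrow> sat \<Phi> a \<and> sat \<Psi> a"
| "sat (Disj \<Phi> \<Psi>) a \<longleftrightarrow> sat \<Phi> a \<or> sat \<Psi> a"

fun polys_of :: "sa_formula \<Rightarrow> rat_mpoly set" where
  "polys_of (Atom r p) = {p}"
| "polys_of (Neg \<Phi>) = polys_of \<Phi>"
| "polys_of (Conj \<Phi> \<Psi>) = polys_of \<Phi> \<union> polys_of \<Psi>"
| "polys_of (Disj \<Phi> \<Psi>) = polys_of \<Phi> \<union> polys_of \<Psi>"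

definition sa_predicate :: "nat \<Rightarrow> nat \<Rightarrow> sa_formula \<Rightarrow> bool" where
  "sa_predicate d k \<Phi> \<longleftrightarrow> (\<forall>p\<in>polys_of \<Phi>. mpoly_vars p \<subseteq> {..<k} \<times> {..<d})"

definition degree_le :: "nat \<Rightarrow> sa_formula \<Rightarrow> bool" where
  "degree_le D \<Phi> \<longleftrightarrow> (\<forall>p\<in>polys_of \<Phi>. mpoly_degree p \<le> D)"

text \<open>The number of atoms and connectives. The size of the polynomials is not counted: it is controlled
  by \<open>d\<close>, \<open>D\<close> and \<open>k\<close>, up to the coefficients.\<close>

fun formula_length :: "sa_formula \<Rightarrow> nat" where
  "formula_length (Atom r p) = 1"
| "formula_length (Neg \<Phi>) = formula_length \<Phi> + 1"
| "formula_length (Conj \<Phi> \<Psi>) = formula_length \<Phi> + formula_length \<Psi> + 1"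
| "formula_length (Disj \<Phi> \<Psi>) = formula_length \<Phi> + formula_length \<Psi> + 1"

text \<open>
  Conjunctions of equations and inequalities, where an inequality is strict or of the form \<open>p \<noteq> 0\<close>.
  Weak inequalities count as disjunctions \<open>p < 0 \<or> p = 0\<close> here: they cannot be allowed in a bound that
  does not depend on the number of conjuncts. For instance, with \<open>d = k = 1\<close>, the quadratic constraints
  \<open>x * (n - x) \<ge> 0\<close> and \<open>(x - i) * (x - i - 1) \<ge> 0\<close> for \<open>0 \<le> i < n\<close> have exactly the \<open>n + 1\<close> common
  solutions \<open>0, 1, \<dots>, n\<close>.
\<close>

fun basic_conjunction :: "sa_formula \<Rightarrow> bool" where
  "basic_conjunction (Atom r p) \<longleftrightarrow> r \<in> {EqZ, NeqZ, LessZ, GreaterZ}"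
| "basic_conjunction (Neg \<Phi>) \<longleftrightarrow> False"
| "basic_conjunction (Conj \<Phi> \<Psi>) \<longleftrightarrow> basic_conjunction \<Phi> \<and> basic_conjunction \<Psi>"
| "basic_conjunction (Disj \<Phi> \<Psi>) \<longleftrightarrow> False"

definition holds_everywhere :: "nat \<Rightarrow> sa_formula \<Rightarrow> (nat \<Rightarrow> point set) \<Rightarrow> bool" where
  "holds_everywhere k \<Phi> A \<longleftrightarrow> (\<forall>a \<in> Pi\<^sub>E {..<k} A. sat \<Phi> a)"

definition holds_on_finite_sets :: "nat \<Rightarrow> nat \<Rightarrow> nat \<Rightarrow> sa_formula \<Rightarrow> bool" where
  "holds_on_finite_sets d k N \<Phi> \<longleftrightarrow>
    (\<exists>A. (\<forall>i<k. A i \<subseteq> topspace (Euclidean_space d) \<and> finite (A i) \<and> card (A i) = N) \<and>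
         holds_everywhere k \<Phi> A)"

definition holds_on_infinite_sets :: "nat \<Rightarrow> nat \<Rightarrow> sa_formula \<Rightarrow> bool" where
  "holds_on_infinite_sets d k \<Phi> \<longleftrightarrow>
    (\<exists>X. (\<forall>i<k. X i \<subseteq> topspace (Euclidean_space d) \<and> infinite (X i)) \<and>
         holds_everywhere k \<Phi> X)"

text \<open>
  That a bound can be given explicitly is expressed by primitive recursiveness. An \<open>n\<close>-ary function takes
  a list of length \<open>n\<close>; its values on lists of other lengths are irrelevant.
\<close>

inductive primitive_recursive :: "nat \<Rightarrow> (nat list \<Rightarrow> nat) \<Rightarrow> bool" where
  zero: "primitive_recursive n (\<lambda>_. 0)"
| succ: "primitive_recursive 1 (\<lambda>xs. Suc (hd xs))"
| proj: "i < n \<Longrightarrow> primitive_recursive n (\<lambda>xs. xs ! i)"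
| comp: "\<lbrakk>primitive_recursive (length gs) f; \<forall>g\<in>set gs. primitive_recursive n g\<rbrakk>
    \<Longrightarrow> primitive_recursive n (\<lambda>xs. f (map (\<lambda>g. g xs) gs))"
| prec: "\<lbrakk>primitive_recursive n f; primitive_recursive (n + 2) g\<rbrakk>
    \<Longrightarrow> primitive_recursive (n + 1)
          (\<lambda>xs. rec_nat (f (tl xs)) (\<lambda>m r. g (m # r # tl xs)) (hd xs))"

end

theory Submission
  imports Defs
begin

text \<open>
  For a conjunction only the equations matter, since strict inequalities survive small perturbations.
  So let some polynomials vanish on \<open>A\<^sub>1 \<times> \<dots> \<times> A\<^sub>k\<close>. Fixing the other coordinates, the set \<open>V\<^sub>1\<close> of all
  points that may be added to \<open>A\<^sub>1\<close> is a real algebraic set of degree at most \<open>D\<close>. If \<open>A\<^sub>1\<close> has more points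
  than such a set can have isolated ones, then some \<open>a\<^sub>1 \<in> A\<^sub>1\<close> is an accumulation point of \<open>V\<^sub>1\<close>.
  Replace \<open>A\<^sub>1\<close> by \<open>V\<^sub>1\<close>, treat \<open>A\<^sub>2, \<dots>, A\<^sub>k\<close> in the same way, and finally intersect every \<open>V\<^sub>i\<close> with a
  small cube around \<open>a\<^sub>i\<close>.

  A real algebraic set of degree at most \<open>D\<close> in \<open>\<real>\<^sup>d\<close> has at most \<open>(2 D + 1)\<^sup>d\<close> isolated points, however
  many equations define it. Surround these points by disjoint small cubes. By compactness finitely
  many of the equations have no common zero on the boundaries; let \<open>F\<close> be the sum of their squares.
  For small \<open>\<delta> > 0\<close> the function \<open>F + \<delta> (\<Sum>j<d. x j ^ (2 D + 2))\<close> attains a minimum in the interior of each cube. Its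
  critical points solve a system \<open>x j ^ (2 D + 1) = h j x\<close> with \<open>h j\<close> of degree at most \<open>2 D\<close>, which
  allows one to rewrite every monomial into monomials with all exponents at most \<open>2 D\<close>. As there are
  \<open>(2 D + 1)\<^sup>d\<close> of these, and polynomials separate points, there are no more solutions than that.

  For an arbitrary formula, colour each tuple by the signs of the polynomials involved and pass to
  a monochromatic box.
\<close>

section \<open>Isolated points of real algebraic sets\<close>

text \<open>Real coefficients are allowed because all but one point of a tuple will be frozen at
  real values. The index \<open>n\<close> is only an upper bound for the degree. Generating the
  space from monomials reduces linear claims to monomials by induction.\<close>

inductive poly_fun :: "nat \<Rightarrow> nat \<Rightarrow> (point \<Rightarrow> real) \<Rightarrow> bool" for d where
  monom: "(\<Sum>j<d. e j) \<le> n \<Longrightarrow> poly_fun d n (\<lambda>x. \<Prod>j<d. x j ^ e j)"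
| scale: "poly_fun d n f \<Longrightarrow> poly_fun d n (\<lambda>x. c * f x)"
| add: "poly_fun d n f \<Longrightarrow> poly_fun d n g \<Longrightarrow> poly_fun d n (\<lambda>x. f x + g x)"

lemma poly_fun_const: "poly_fun d n (\<lambda>_. c)"
  using poly_fun.scale[OF poly_fun.monom[where e = "\<lambda>_. 0"], of d n c] by simp

lemma poly_fun_coord_power:
  assumes "j < d" "m \<le> n"
  shows "poly_fun d n (\<lambda>x. x j ^ m)"
proof -
  have "x j ^ m = (\<Prod>i<d. x i ^ (if i = j then m else 0))" for x :: point
  proof -
    have "(\<Prod>i<d. x i ^ (if i = j then m else 0)) = (\<Prod>i<d. if i = j then x i ^ m else 1)"
      by (intro prod.cong) auto
    then show ?thesis using assms by simp
  qed
  then show ?thesis using poly_fun.monom[where e = "\<lambda>i. if i = j then m else 0" and d = d and n = n] assms by simp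
qed

lemma poly_fun_mono: "poly_fun d n f \<Longrightarrow> n \<le> m \<Longrightarrow> poly_fun d m f"
  by (induction rule: poly_fun.induct) (auto intro: poly_fun.intros)

lemma poly_fun_mult:
  assumes "poly_fun d n f" "poly_fun d m g"
  shows "poly_fun d (n + m) (\<lambda>x. f x * g x)"
  using assms
proof (induction arbitrary: g rule: poly_fun.induct)
  case (monom e n)
  show ?case using monom(2) monom(1)
  proof (induction rule: poly_fun.induct)
    case (monom e' m)
    have "poly_fun d (n + m) (\<lambda>x. \<Prod>j<d. x j ^ (e j + e' j))"
      by (rule poly_fun.monom) (use monom in \<open>simp add: sum.distrib\<close>)
    then show ?case by (simp add: power_add prod.distrib)
  next
    case (scale m f c)
    then show ?case using poly_fun.scale[where n = "n + m" and c = c] by (simp add: mult.left_commute)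
  next
    case (add m f g)
    then show ?case using poly_fun.add by (simp add: distrib_left)
  qed
next
  case (scale n f c)
  then show ?case using poly_fun.scale[where n = "n + m" and c = c] by (simp add: mult.assoc)
next
  case (add n f g)
  then show ?case using poly_fun.add by (simp add: distrib_right)
qed

lemma poly_fun_sum: "(\<And>i. i \<in> I \<Longrightarrow> poly_fun d n (f i)) \<Longrightarrow> poly_fun d n (\<lambda>x. \<Sum>i\<in>I. f i x)"
  by (induction I rule: infinite_finite_induct) (auto intro: poly_fun_const poly_fun.add)

lemma poly_fun_prod:
  "(\<And>i. i \<in> I \<Longrightarrow> poly_fun d (n i) (f i)) \<Longrightarrow> poly_fun d (\<Sum>i\<in>I. n i) (\<lambda>x. \<Prod>i\<in>I. f i x)"
  by (induction I rule: infinite_finite_induct) (auto intro: poly_fun_const poly_fun_mult)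

lemma continuous_on_poly_fun: "poly_fun d n f \<Longrightarrow> continuous_on S f"
  by (induction rule: poly_fun.induct)
     (auto intro!: continuous_intros continuous_on_subset[OF continuous_on_product_coordinates])

lemma poly_fun_partial_derivative:
  assumes "poly_fun d n f" "j < d"
  shows "\<exists>g. poly_fun d n g \<and> (\<forall>x. ((\<lambda>t. f (x(j := t))) has_real_derivative g x) (at (x j)))"
  using assms
proof (induction rule: poly_fun.induct)
  case (monom e n)
  \<comment> \<open>The subtraction is truncated, but if \<open>e j = 0\<close> the factor
    \<open>real (e j)\<close> kills the term. The bound \<open>n\<close> is kept instead of being
    lowered by one, which is precise enough later.\<close>
  let ?e = "e(j := e j - 1)"
  let ?g = "\<lambda>x. real (e j) * (\<Prod>i<d. x i ^ ?e i)"
  have split: "(\<Prod>i<d. F i) = F j * (\<Prod>i\<in>{..<d} - {j}. F i)" for F :: "nat \<Rightarrow> real"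
    using monom(2) by (simp add: prod.remove)
  have "(\<Sum>i<d. ?e i) \<le> (\<Sum>i<d. e i)" by (intro sum_mono) auto
  then have "poly_fun d n ?g" using monom(1) by (intro poly_fun.scale poly_fun.monom) simp
  moreover have "((\<lambda>t. \<Prod>i<d. (x(j := t)) i ^ e i) has_real_derivative ?g x) (at (x j))" for x :: point
  proof -
    let ?c = "\<Prod>i\<in>{..<d} - {j}. x i ^ e i"
    have "(\<lambda>t. \<Prod>i<d. (x(j := t)) i ^ e i) = (\<lambda>t. t ^ e j * ?c)"
      by (simp add: split)
    moreover have "((\<lambda>t. t ^ e j * ?c) has_real_derivative real (e j) * x j ^ (e j - 1) * ?c) (at (x j))"
      by (auto intro!: derivative_eq_intros)
    moreover have "?g x = real (e j) * x j ^ (e j - 1) * ?c" by (simp add: split)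
    ultimately show ?thesis by presburger
  qed
  ultimately show ?case by blast
next
  case (scale n f c)
  then obtain g where "poly_fun d n g" "\<And>x. ((\<lambda>t. f (x(j := t))) has_real_derivative g x) (at (x j))"
    by blast
  then show ?case
    by (intro exI[of _ "\<lambda>x. c * g x"]) (auto intro: poly_fun.scale DERIV_cmult simp del: fun_upd_apply)
next
  case (add n f1 f2)
  then obtain g1 g2 where "poly_fun d n g1" "\<And>x. ((\<lambda>t. f1 (x(j := t))) has_real_derivative g1 x) (at (x j))"
    "poly_fun d n g2" "\<And>x. ((\<lambda>t. f2 (x(j := t))) has_real_derivative g2 x) (at (x j))"
    by blast
  then show ?case
    by (intro exI[of _ "\<lambda>x. g1 x + g2 x"]) (auto intro: poly_fun.add DERIV_add simp del: fun_upd_apply)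
qed

section \<open>Counting solutions of polynomial systems by linear algebra\<close>

lemma homogeneous_system_nontrivial_solution:
  fixes F :: "'i \<Rightarrow> 'a \<Rightarrow> real"
  assumes "finite I" "finite Z" "card I < card Z"
  shows "\<exists>w. (\<exists>z\<in>Z. w z \<noteq> 0) \<and> (\<forall>i\<in>I. (\<Sum>z\<in>Z. w z * F i z) = 0)"
  using assms
proof (induction I arbitrary: Z F rule: finite_induct)
  case empty
  then show ?case by (intro exI[of _ "\<lambda>_. 1"]) (auto simp: card_gt_0_iff)
next
  case (insert i I)
  show ?case
  proof (cases "\<forall>z\<in>Z. F i z = 0")
    case True
    obtain w where "\<exists>z\<in>Z. w z \<noteq> 0" "\<forall>i\<in>I. (\<Sum>z\<in>Z. w z * F i z) = 0"
      using insert.IH[OF insert.prems(1), of F] insert.prems(2) insert.hyps by auto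
    with True show ?thesis by (intro exI[of _ w]) auto
  next
    case False
    then obtain p where p: "p \<in> Z" "F i p \<noteq> 0" by blast
    let ?Z = "Z - {p}"
    have "card I < card ?Z" using insert p by simp
    \<comment> \<open>Gaussian elimination: subtracting multiples of equation \<open>i\<close>
      removes the unknown at \<open>p\<close> from the other equations. The smaller system is solved
      by induction, and equation \<open>i\<close> then dictates the value at
      \<open>p\<close>.\<close>
    then obtain w where w: "\<exists>z\<in>?Z. w z \<noteq> 0"
      "\<forall>l\<in>I. (\<Sum>z\<in>?Z. w z * (F l z - F l p * F i z / F i p)) = 0"
      using insert.IH[OF finite_Diff[OF insert.prems(1)],
          of "{p}" "\<lambda>l z. F l z - F l p * F i z / F i p"] by blast
    define s where "s = (\<Sum>z\<in>?Z. w z * F i z)"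
    define v where "v = w(p := - s / F i p)"
    have sum_v: "(\<Sum>z\<in>Z. v z * G z) = - s / F i p * G p + (\<Sum>z\<in>?Z. w z * G z)" for G
    proof -
      have "(\<Sum>z\<in>Z. v z * G z) = v p * G p + (\<Sum>z\<in>?Z. v z * G z)"
        using p insert.prems by (simp add: sum.remove)
      also have "(\<Sum>z\<in>?Z. v z * G z) = (\<Sum>z\<in>?Z. w z * G z)"
        by (intro sum.cong) (auto simp: v_def)
      finally show ?thesis by (simp add: v_def)
    qed
    have "(\<Sum>z\<in>Z. v z * F l z) = 0" if "l \<in> I" for l
    proof -
      have "(\<Sum>z\<in>?Z. w z * F l z) - F l p / F i p * s = 0"
        using w(2) that by (simp add: s_def sum_distrib_left sum_subtractf algebra_simps)
      then show ?thesis unfolding sum_v by simp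
    qed
    moreover have "(\<Sum>z\<in>Z. v z * F i z) = 0" unfolding sum_v using p by (simp add: s_def)
    moreover have "\<exists>z\<in>Z. v z \<noteq> 0" using w(1) by (auto simp: v_def)
    ultimately show ?thesis by (intro exI[of _ v]) auto
  qed
qed

lemma poly_fun_interpolation:
  assumes "finite Z" "z \<in> Z" "\<And>x y. x \<in> Z \<Longrightarrow> y \<in> Z \<Longrightarrow> x \<noteq> y \<Longrightarrow> \<exists>j<d. x j \<noteq> y j"
  shows "\<exists>n f. poly_fun d n f \<and> f z \<noteq> 0 \<and> (\<forall>y\<in>Z. y \<noteq> z \<longrightarrow> f y = 0)"
proof -
  have "\<exists>j<d. y j \<noteq> z j" if "y \<in> Z - {z}" for y using assms that by blast
  then obtain j where j: "\<And>y. y \<in> Z - {z} \<Longrightarrow> j y < d \<and> y (j y) \<noteq> z (j y)" by metis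
  \<comment> \<open>For every other \<open>y\<close> one linear factor vanishes at \<open>y\<close>
    but not at \<open>z\<close>, in a coordinate where the two points differ.\<close>
  let ?f = "\<lambda>x :: point. \<Prod>y\<in>Z - {z}. x (j y) + - y (j y)"
  have "poly_fun d 1 (\<lambda>x. x (j y) + - y (j y))" if "y \<in> Z - {z}" for y
    using poly_fun.add[OF poly_fun_coord_power[of "j y" d 1 1] poly_fun_const[of d 1 "- y (j y)"]] j[OF that]
    by simp
  then have "poly_fun d (\<Sum>y\<in>Z - {z}. 1) ?f" by (rule poly_fun_prod)
  moreover have "?f z \<noteq> 0" using j assms(1) by (force simp: prod_zero_iff)
  moreover have "?f y = 0" if "y \<in> Z" "y \<noteq> z" for y
    using that assms(1) by (simp add: prod_zero_iff) blast
  ultimately show ?thesis by blast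
qed

text \<open>A dual dimension count. With more than \<open>m ^ d\<close> points there would be
  nontrivial weights on \<open>Z\<close> annihilating every monomial with all exponents below
  \<open>m\<close>. The rewriting rule spreads this to all monomials, hence to all polynomials,
  against the existence of a polynomial that singles out one point of nonzero weight.\<close>

lemma card_zeros_le:
  assumes "finite Z" and "0 < m"
    and sep: "\<And>x y. x \<in> Z \<Longrightarrow> y \<in> Z \<Longrightarrow> x \<noteq> y \<Longrightarrow> \<exists>j<d. x j \<noteq> y j"
    and h: "\<And>j. j < d \<Longrightarrow> poly_fun d (m - 1) (h j)"
    and Z: "\<And>z j. z \<in> Z \<Longrightarrow> j < d \<Longrightarrow> z j ^ m = h j z"
  shows "card Z \<le> m ^ d"
proof (rule ccontr)
  define I where "I = Pi\<^sub>E {..<d} (\<lambda>_. {..<m})"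
  have "finite I" "card I = m ^ d" by (auto simp: I_def card_PiE intro: finite_PiE)
  moreover assume "\<not> card Z \<le> m ^ d"
  ultimately obtain w where nz: "\<exists>z\<in>Z. w z \<noteq> 0"
    and w: "\<And>e. e \<in> I \<Longrightarrow> (\<Sum>z\<in>Z. w z * (\<Prod>j<d. z j ^ e j)) = 0"
    using homogeneous_system_nontrivial_solution[of I Z "\<lambda>e z. \<Prod>j<d. z j ^ e j"] assms(1) by auto
  define L where "L f = (\<Sum>z\<in>Z. w z * f z)" for f
  have L_cong: "L f = L g" if "\<And>z. z \<in> Z \<Longrightarrow> f z = g z" for f g
    unfolding L_def by (intro sum.cong) (auto simp: that)
  have L_mono: "L f = 0" if "poly_fun d n f" "\<And>e. (\<Sum>j<d. e j) \<le> n \<Longrightarrow> L (\<lambda>x. \<Prod>j<d. x j ^ e j) = 0"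
    for n f using that
  proof (induction rule: poly_fun.induct)
    case (scale n f c)
    have "L (\<lambda>x. c * f x) = c * L f" by (simp add: L_def sum_distrib_left mult.left_commute)
    with scale show ?case by simp
  next
    case (add n f g)
    have "L (\<lambda>x. f x + g x) = L f + L g" by (simp add: L_def sum.distrib distrib_left)
    with add show ?case by simp
  qed simp
  have L_monom: "L (\<lambda>x. \<Prod>j<d. x j ^ e j) = 0" for e :: "nat \<Rightarrow> nat"
  proof (induction "\<Sum>j<d. e j" arbitrary: e rule: less_induct)
    case less
    show ?case
    proof (cases "\<forall>j<d. e j < m")
      case True
      \<comment> \<open>Exponents beyond \<open>d\<close> do not affect the monomial; restricting
        them only makes the exponent function a member of the extensional set
        \<open>I\<close>.\<close>
      then have "restrict e {..<d} \<in> I" by (auto simp: I_def)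
      from w[OF this] show ?thesis by (simp add: L_def)
    next
      case False
      then obtain i where i: "i < d" "m \<le> e i" by (auto simp: not_less)
      let ?e = "e(i := e i - m)"
      let ?f = "\<lambda>x. (\<Prod>j<d. x j ^ ?e j) * h i x"
      have sum_e: "(\<Sum>j<d. e j) = (\<Sum>j<d. ?e j) + m"
      proof -
        have "(\<Sum>j<d. e j) = e i + (\<Sum>j\<in>{..<d} - {i}. e j)" using i by (simp add: sum.remove)
        moreover have "(\<Sum>j<d. ?e j) = ?e i + (\<Sum>j\<in>{..<d} - {i}. ?e j)"
          using i by (subst sum.remove[of _ i]) auto
        moreover have "(\<Sum>j\<in>{..<d} - {i}. ?e j) = (\<Sum>j\<in>{..<d} - {i}. e j)"
          by (intro sum.cong) auto
        ultimately show ?thesis using i by simp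
      qed
      have "L (\<lambda>x. \<Prod>j<d. x j ^ e j) = L ?f"
      proof (rule L_cong)
        fix z assume z: "z \<in> Z"
        have "(\<Prod>j<d. z j ^ e j) = z i ^ e i * (\<Prod>j\<in>{..<d} - {i}. z j ^ e j)"
          using i by (simp add: prod.remove)
        moreover have "(\<Prod>j<d. z j ^ ?e j) = z i ^ ?e i * (\<Prod>j\<in>{..<d} - {i}. z j ^ ?e j)"
          using i by (subst prod.remove[of _ i]) auto
        moreover have "(\<Prod>j\<in>{..<d} - {i}. z j ^ ?e j) = (\<Prod>j\<in>{..<d} - {i}. z j ^ e j)"
          by (intro prod.cong) auto
        moreover have "z i ^ e i = z i ^ ?e i * h i z"
          using Z[OF z i(1)] i(2) by (metis fun_upd_same le_add_diff_inverse2 power_add)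
        ultimately show "(\<Prod>j<d. z j ^ e j) = ?f z" by (simp add: ac_simps)
      qed
      also have "\<dots> = 0"
      proof (rule L_mono)
        show "poly_fun d ((\<Sum>j<d. ?e j) + (m - 1)) ?f"
          by (intro poly_fun_mult poly_fun.monom h i) simp
        fix e' :: "nat \<Rightarrow> nat" assume "(\<Sum>j<d. e' j) \<le> (\<Sum>j<d. ?e j) + (m - 1)"
        \<comment> \<open>Trading the factor of degree \<open>m\<close> for one of degree at most
          \<open>m - 1\<close> lowers the total degree, so the induction hypothesis covers every
          monomial of the rewritten polynomial.\<close>
        then have "(\<Sum>j<d. e' j) < (\<Sum>j<d. e j)" using sum_e assms(2) by linarith
        then show "L (\<lambda>x. \<Prod>j<d. x j ^ e' j) = 0" by (rule less)
      qed
      finally show ?thesis .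
    qed
  qed
  obtain z where z: "z \<in> Z" "w z \<noteq> 0" using nz by blast
  obtain n f where f: "poly_fun d n f" "f z \<noteq> 0" "\<And>y. y \<in> Z \<Longrightarrow> y \<noteq> z \<Longrightarrow> f y = 0"
    using poly_fun_interpolation[OF assms(1) z(1) sep] by blast
  have "L f = w z * f z + (\<Sum>y\<in>Z - {z}. w y * f y)"
    unfolding L_def using z assms(1) by (simp add: sum.remove)
  also have "(\<Sum>y\<in>Z - {z}. w y * f y) = 0" using f(3) by (intro sum.neutral) auto
  finally show False using L_mono[OF f(1) L_monom] z f(2) by simp
qed

section \<open>Cubes, compactness and the bound for isolated zeros\<close>

definition cube :: "nat \<Rightarrow> point \<Rightarrow> real \<Rightarrow> point set" where
  "cube d a r = {x \<in> topspace (Euclidean_space d). \<forall>j<d. \<bar>x j - a j\<bar> \<le> r}"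

lemma compact_cube: "compact (cube d a r)"
proof -
  \<comment> \<open>Points of the Euclidean space are sequences that vanish from index
    \<open>d\<close> on. So a cube is a full product with one-point factors there, and Tychonoff's
    theorem applies.\<close>
  let ?S = "\<lambda>j. if j < d then {a j - r..a j + r} else {0 :: real}"
  have "x \<in> cube d a r \<longleftrightarrow> x \<in> Pi\<^sub>E UNIV ?S" for x
    unfolding cube_def topspace_Euclidean_space PiE_UNIV_domain Pi_iff
    by (force simp: abs_le_iff abs_diff_le_iff not_less split: if_splits)
  then have "cube d a r = Pi\<^sub>E UNIV ?S" by blast
  moreover have "compactin (product_topology (\<lambda>_. euclidean) UNIV) (Pi\<^sub>E UNIV ?S)"
    unfolding compactin_PiE by simp
  ultimately show ?thesis by (simp add: euclidean_product_topology)
qed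

lemma Euclidean_space_eqI:
  assumes "x \<in> topspace (Euclidean_space d)" "y \<in> topspace (Euclidean_space d)" "\<And>j. j < d \<Longrightarrow> x j = y j"
  shows "x = y"
proof
  show "x j = y j" for j
    using assms by (cases "j < d") (simp_all add: topspace_Euclidean_space)
qed

text \<open>Used to shrink a cube with finitely many zeros to one whose only zero is its centre.
  Half the distance in a differing coordinate excludes each other point.\<close>

lemma isolated_in_finite_set:
  assumes "finite S" "S \<subseteq> topspace (Euclidean_space d)" "a \<in> topspace (Euclidean_space d)"
  shows "\<exists>r>0. cube d a r \<inter> S \<subseteq> {a}"
  using assms(1,2)
proof (induction S rule: finite_induct)
  case empty
  show ?case by (rule exI[of _ 1]) simp
next
  case (insert s S)
  then obtain r where r: "r > 0" "cube d a r \<inter> S \<subseteq> {a}" by auto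
  show ?case
  proof (cases "s = a")
    case True
    with r show ?thesis by auto
  next
    case False
    then obtain j where j: "j < d" "s j \<noteq> a j" using Euclidean_space_eqI[of s d a] insert assms(3) by auto
    let ?r = "min r (\<bar>s j - a j\<bar> / 2)"
    have "cube d a ?r \<subseteq> cube d a r" by (auto simp: cube_def)
    moreover have "s \<notin> cube d a ?r" using j by (force simp: cube_def)
    ultimately show ?thesis using r j by (intro exI[of _ ?r]) auto
  qed
qed

text \<open>Isolation is phrased through finiteness so that its failure says exactly that every cube
  around the point contains infinitely many common zeros. The family of equations may be
  infinite.\<close>

lemma card_isolated_zeros_le:
  assumes finA: "finite A" and A: "A \<subseteq> topspace (Euclidean_space d)"
    and poly: "\<And>f. f \<in> \<F> \<Longrightarrow> poly_fun d D f"
    and zero: "\<And>f a. f \<in> \<F> \<Longrightarrow> a \<in> A \<Longrightarrow> f a = 0"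
    and isolated: "\<And>a. a \<in> A \<Longrightarrow> \<exists>r>0. finite {x \<in> cube d a r. \<forall>f\<in>\<F>. f x = 0}"
  shows "card A \<le> (2 * D + 1) ^ d"
proof -
  have "\<exists>r>0. \<forall>x\<in>cube d a r. (\<forall>f\<in>\<F>. f x = 0) \<longrightarrow> x = a" if a: "a \<in> A" for a
  proof -
    obtain r where r: "r > 0" "finite {x \<in> cube d a r. \<forall>f\<in>\<F>. f x = 0}" using isolated[OF a] by blast
    have "{x \<in> cube d a r. \<forall>f\<in>\<F>. f x = 0} \<subseteq> topspace (Euclidean_space d)"
      unfolding cube_def by blast
    from isolated_in_finite_set[OF r(2) this, of a] A a
    obtain s where s: "s > 0" "cube d a s \<inter> {x \<in> cube d a r. \<forall>f\<in>\<F>. f x = 0} \<subseteq> {a}" by blast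
    have "cube d a (min r s) \<subseteq> cube d a r \<inter> cube d a s" by (auto simp: cube_def)
    then have "\<forall>x\<in>cube d a (min r s). (\<forall>f\<in>\<F>. f x = 0) \<longrightarrow> x = a" using s(2) by blast
    then show ?thesis using r(1) s(1) by (meson min_less_iff_conj)
  qed
  then obtain e where e: "\<And>a. a \<in> A \<Longrightarrow> e a > 0"
    and e': "\<And>a x. a \<in> A \<Longrightarrow> x \<in> cube d a (e a) \<Longrightarrow> (\<forall>f\<in>\<F>. f x = 0) \<Longrightarrow> x = a" by metis
  \<comment> \<open>With a third of a common isolation radius, centres of cubes that share a point
    are within \<open>2 * r\<close>, inside each other's isolation cubes. The inserted
    \<open>1\<close> covers empty \<open>A\<close>.\<close>
  define r where "r = Min (insert 1 (e ` A)) / 3"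
  have r: "r > 0" using e finA by (auto simp: r_def)
  have re: "3 * r \<le> e a" if "a \<in> A" for a using that finA by (auto simp: r_def intro: Min_le)
  define bd where "bd a = cube d a r \<inter> (\<Union>j<d. {x. \<bar>x j - a j\<bar> = r})" for a
  have "closed (\<Union>j<d. {x :: point. \<bar>x j - a j\<bar> = r})" for a
    by (intro closed_UN ballI closed_Collect_eq continuous_intros continuous_on_product_coordinates) auto
  then have compact_bd: "compact (bd a)" for a
    unfolding bd_def by (intro compact_Int_closed compact_cube)
  define S where "S = (\<Union>a\<in>A. bd a)"
  have compact_S: "compact S" unfolding S_def using finA compact_bd by (rule compact_UN)
  have "\<exists>f\<in>\<F>. f x \<noteq> 0" if x: "x \<in> S" for x
  proof -
    obtain a where a: "a \<in> A" "x \<in> bd a" using x by (auto simp: S_def)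
    have "r \<le> e a" using re[OF a(1)] r by linarith
    then have "cube d a r \<subseteq> cube d a (e a)" by (auto simp: cube_def)
    then have "x \<in> cube d a (e a)" using a by (auto simp: bd_def)
    moreover have "x \<noteq> a" using a r by (auto simp: bd_def)
    ultimately show ?thesis using e' a by blast
  qed
  then have cover: "S \<subseteq> (\<Union>f\<in>\<F>. {x. f x \<noteq> 0})" by blast
  have opn: "open {x. f x \<noteq> 0}" if "f \<in> \<F>" for f
    using continuous_on_poly_fun[OF poly[OF that], of UNIV] by (intro open_Collect_neq) auto
  \<comment> \<open>Compactness of the boundaries leaves finitely many equations, so that a sum of
    squares makes sense; squaring doubles the degree.\<close>
  obtain \<G> where G: "\<G> \<subseteq> \<F>" "finite \<G>" "S \<subseteq> (\<Union>f\<in>\<G>. {x. f x \<noteq> 0})"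
    using compactE_image[OF compact_S opn cover] by blast
  define F where "F x = (\<Sum>f\<in>\<G>. f x * f x)" for x
  have polyF: "poly_fun d (2 * D) F"
    unfolding F_def mult_2 using G poly by (intro poly_fun_sum poly_fun_mult) auto
  have F_zero: "F a = 0" if "a \<in> A" for a
    unfolding F_def using zero that G by (intro sum.neutral) auto
  have F_pos: "F x > 0" if x: "x \<in> S" for x
  proof -
    obtain f where "f \<in> \<G>" "f x \<noteq> 0" using G x by blast
    then show ?thesis unfolding F_def using G by (intro sum_pos2[of _ f]) (auto simp: zero_less_mult_iff)
  qed
  \<comment> \<open>\<open>S\<close> is empty if \<open>A\<close> is empty or \<open>d = 0\<close>;
    any positive constant then serves.\<close>
  have "\<exists>\<mu>>0. \<forall>x\<in>S. \<mu> \<le> F x"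
  proof (cases "S = {}")
    case False
    with continuous_attains_inf[OF compact_S _ continuous_on_poly_fun[OF polyF]] F_pos
    show ?thesis by blast
  qed (auto intro: exI[of _ 1])
  then obtain \<mu> where mu: "\<mu> > 0" "\<And>x. x \<in> S \<Longrightarrow> \<mu> \<le> F x" by blast
  \<comment> \<open>The even exponent keeps \<open>h\<close> nonnegative, and its derivative has
    exponent \<open>2 * D + 1\<close>, just above the degree bound \<open>2 * D\<close> for the
    derivatives of \<open>F\<close>.\<close>
  define h where "h x = (\<Sum>j<d. x j ^ (2 * D + 2))" for x :: point
  have h_nonneg: "h x \<ge> 0" for x unfolding h_def by (intro sum_nonneg zero_le_even_power) simp
  \<comment> \<open>This makes \<open>\<delta> * h a < \<mu>\<close> for all \<open>a\<close> in
    \<open>A\<close> at once: the perturbed function is below \<open>\<mu>\<close> at each centre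
    and at least \<open>\<mu>\<close> on each boundary. The summand \<open>1\<close> keeps the
    denominator positive.\<close>
  define \<delta> where "\<delta> = \<mu> / (1 + (\<Sum>a\<in>A. h a))"
  have H: "0 \<le> (\<Sum>a\<in>A. h a)" using h_nonneg by (intro sum_nonneg)
  have delta: "\<delta> > 0" unfolding \<delta>_def using mu H by simp
  have delta_h: "\<delta> * h a < \<mu>" if "a \<in> A" for a
  proof -
    have "h a \<le> (\<Sum>a\<in>A. h a)" using finA that h_nonneg by (intro member_le_sum) auto
    then have "\<mu> * h a < \<mu> * (1 + (\<Sum>a\<in>A. h a))" using mu by (intro mult_strict_left_mono) auto
    then show ?thesis using H unfolding \<delta>_def by (simp add: field_simps)
  qed
  define Q where "Q x = F x + \<delta> * h x" for x
  have polyQ: "poly_fun d (2 * D + 2) Q"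
    unfolding Q_def h_def using polyF
    by (intro poly_fun.add poly_fun.scale poly_fun_sum poly_fun_coord_power) (auto intro: poly_fun_mono)
  have "\<exists>F'. \<forall>j<d. poly_fun d (2 * D) (F' j) \<and>
      (\<forall>x. ((\<lambda>t. F (x(j := t))) has_real_derivative F' j x) (at (x j)))"
    using poly_fun_partial_derivative[OF polyF] by metis
  then obtain F' where polyF': "\<And>j. j < d \<Longrightarrow> poly_fun d (2 * D) (F' j)"
    and F': "\<And>j x. j < d \<Longrightarrow> ((\<lambda>t. F (x(j := t))) has_real_derivative F' j x) (at (x j))" by blast
  define c where "c = \<delta> * real (2 * D + 2)"
  have c: "c > 0" using delta by (simp add: c_def)
  have Q': "((\<lambda>t. Q (x(j := t))) has_real_derivative F' j x + c * x j ^ (2 * D + 1)) (at (x j))"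
    if j: "j < d" for j x
  proof -
    have "h (x(j := t)) = t ^ (2 * D + 2) + (\<Sum>i\<in>{..<d} - {j}. x i ^ (2 * D + 2))" for t
      unfolding h_def using j by (simp add: sum.remove[of _ j])
    moreover have "2 * D + 2 - Suc 0 = 2 * D + 1" by simp
    then have "((\<lambda>t. t ^ (2 * D + 2) + (\<Sum>i\<in>{..<d} - {j}. x i ^ (2 * D + 2)))
        has_real_derivative real (2 * D + 2) * x j ^ (2 * D + 1)) (at (x j))"
      using DERIV_add[OF DERIV_pow[of "2 * D + 2" "x j"] DERIV_const] by (simp only: add_0_right)
    ultimately have "((\<lambda>t. h (x(j := t))) has_real_derivative real (2 * D + 2) * x j ^ (2 * D + 1)) (at (x j))"
      by presburger
    from DERIV_add[OF F'[OF j, of x] DERIV_cmult[OF this, of \<delta>]]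
    show ?thesis unfolding Q_def c_def by (simp only: mult.assoc)
  qed
  have "\<exists>p. p \<in> cube d a r \<and> (\<forall>j<d. F' j p + c * p j ^ (2 * D + 1) = 0)" if a: "a \<in> A" for a
  proof -
    have a_cube: "a \<in> cube d a r" using a A r by (auto simp: cube_def)
    then obtain p where p: "p \<in> cube d a r" "\<And>y. y \<in> cube d a r \<Longrightarrow> Q p \<le> Q y"
      using continuous_attains_inf[OF compact_cube _ continuous_on_poly_fun[OF polyQ]] by blast
    have "Q p < \<mu>" using p(2)[OF a_cube] F_zero[OF a] delta_h[OF a] by (simp add: Q_def)
    moreover have "F p \<le> Q p" using delta h_nonneg by (simp add: Q_def)
    \<comment> \<open>A minimiser on the boundary would have value at least \<open>\<mu>\<close>.
      Being interior, \<open>p\<close> can be varied along each coordinate, and the partial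
      derivatives vanish.\<close>
    ultimately have "p \<notin> bd a" using mu(2)[of p] a by (force simp: S_def)
    then have interior: "\<bar>p j - a j\<bar> < r" if "j < d" for j
      using p(1) that by (force simp: bd_def cube_def)
    have "F' j p + c * p j ^ (2 * D + 1) = 0" if j: "j < d" for j
    proof (rule DERIV_local_min[OF Q'[OF j]])
      show "0 < r - \<bar>p j - a j\<bar>" using interior[OF j] by simp
      show "\<forall>y. \<bar>p j - y\<bar> < r - \<bar>p j - a j\<bar> \<longrightarrow> Q (p(j := p j)) \<le> Q (p(j := y))"
      proof (intro allI impI)
        fix y assume "\<bar>p j - y\<bar> < r - \<bar>p j - a j\<bar>"
        then have "p(j := y) \<in> cube d a r"
          using p(1) j by (auto simp: cube_def topspace_Euclidean_space)
        then show "Q (p(j := p j)) \<le> Q (p(j := y))" using p(2) by simp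
      qed
    qed
    then show ?thesis using p(1) by blast
  qed
  then obtain p where p: "\<And>a. a \<in> A \<Longrightarrow> p a \<in> cube d a r"
    and crit: "\<And>a j. a \<in> A \<Longrightarrow> j < d \<Longrightarrow> F' j (p a) + c * p a j ^ (2 * D + 1) = 0" by metis
  \<comment> \<open>Equal minimisers for \<open>a\<close> and \<open>b\<close> would place
    \<open>b\<close> in the isolation cube of \<open>a\<close>, where \<open>a\<close> is the only
    common zero.\<close>
  have "inj_on p A"
  proof (rule inj_onI)
    fix a b assume ab: "a \<in> A" "b \<in> A" "p a = p b"
    have "\<bar>b j - a j\<bar> \<le> e a" if "j < d" for j
    proof -
      have "\<bar>p a j - a j\<bar> \<le> r" "\<bar>p a j - b j\<bar> \<le> r"
        using p[OF ab(1)] p[OF ab(2)] ab(3) that by (auto simp: cube_def)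
      then show ?thesis using re[OF ab(1)] r by linarith
    qed
    then have "b \<in> cube d a (e a)" using A ab by (auto simp: cube_def)
    then show "a = b" using e'[OF ab(1)] zero ab(2) by blast
  qed
  then have "card A = card (p ` A)" by (simp add: card_image)
  also have "\<dots> \<le> (2 * D + 1) ^ d"
  proof (rule card_zeros_le)
    show "finite (p ` A)" using finA by simp
    show "\<exists>j<d. x j \<noteq> y j" if "x \<in> p ` A" "y \<in> p ` A" "x \<noteq> y" for x y
      using that p Euclidean_space_eqI[of x d y] unfolding cube_def by blast
    \<comment> \<open>Dividing the critical equations by \<open>c\<close> solves them for the powers
      \<open>2 * D + 1\<close>, with right-hand sides of degree at most
      \<open>2 * D\<close>.\<close>
    show "poly_fun d (2 * D + 1 - 1) (\<lambda>x. - (1 / c) * F' j x)" if "j < d" for j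
      using poly_fun.scale[OF polyF'[OF that], of "- (1 / c)"] by simp
    show "z j ^ (2 * D + 1) = - (1 / c) * F' j z" if z: "z \<in> p ` A" and j: "j < d" for z j
    proof -
      have "F' j z + c * z j ^ (2 * D + 1) = 0" using z crit j by blast
      then have "c * z j ^ (2 * D + 1) = - F' j z" by linarith
      then show ?thesis using c by (simp add: field_simps)
    qed
  qed simp
  finally show ?thesis .
qed

section \<open>Enlarging the factors of a box one at a time\<close>

lemma vanishing_extends_to_infinite_sets:
  fixes A :: "nat \<Rightarrow> point set"
  assumes A: "\<And>i. i < k \<Longrightarrow> finite (A i) \<and> A i \<subseteq> topspace (Euclidean_space d) \<and> (2 * D + 1) ^ d < card (A i)"
    and poly: "\<And>G a i. G \<in> E \<Longrightarrow> i < k \<Longrightarrow> poly_fun d D (\<lambda>x. G (a(i := x)))"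
    and zero: "\<And>G a. G \<in> E \<Longrightarrow> a \<in> Pi\<^sub>E {..<k} A \<Longrightarrow> G a = 0"
  shows "\<exists>V p. (\<forall>i<k. p i \<in> A i \<and> V i \<subseteq> topspace (Euclidean_space d) \<and>
            (\<forall>r>0. infinite (V i \<inter> cube d (p i) r))) \<and>
          (\<forall>G\<in>E. \<forall>a\<in>Pi\<^sub>E {..<k} V. G a = 0)"
proof -
  \<comment> \<open>The induction passes through mixed boxes whose first \<open>n\<close> factors
    are already enlarged. Accumulation at \<open>p i\<close>, not mere infinity of
    \<open>V i\<close>, is recorded so that intersecting with small cubes still leaves infinite
    sets.\<close>
  have "\<exists>V p. (\<forall>i<n. p i \<in> A i \<and> V i \<subseteq> topspace (Euclidean_space d) \<and>
            (\<forall>r>0. infinite (V i \<inter> cube d (p i) r))) \<and>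
          (\<forall>G\<in>E. \<forall>a\<in>Pi\<^sub>E {..<k} (\<lambda>i. if i < n then V i else A i). G a = 0)" if "n \<le> k" for n
    using that
  proof (induction n)
    case 0
    then show ?case using zero by simp
  next
    case (Suc n)
    then have "n \<le> k" by simp
    from Suc.IH[OF this] obtain V p where
        p': "\<forall>i<n. p i \<in> A i \<and> V i \<subseteq> topspace (Euclidean_space d) \<and>
            (\<forall>r>0. infinite (V i \<inter> cube d (p i) r))"
      and V': "\<forall>G\<in>E. \<forall>a\<in>Pi\<^sub>E {..<k} (\<lambda>i. if i < n then V i else A i). G a = 0"
      by blast
    note p = p'[rule_format]
    note V = V'[rule_format]
    define B where "B = (\<lambda>i. if i < n then V i else A i)"
    note V = V[folded B_def]
    let ?P = "Pi\<^sub>E {..<k} B"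
    have Bn: "B n = A n" by (simp add: B_def)
    have upd: "b(n := x) \<in> ?P" if b: "b \<in> Pi\<^sub>E {..<k} (B(n := Y))" and x: "x \<in> A n" for b x Y
    proof (rule PiE_I)
      fix i assume "i \<in> {..<k}"
      then show "(b(n := x)) i \<in> B i" using PiE_mem[OF b, of i] x Bn by auto
    qed (use b \<open>Suc n \<le> k\<close> in \<open>auto simp: PiE_iff extensional_def\<close>)
    \<comment> \<open>One equation in the \<open>n\<close>-th point for every way of freezing the
      others. The enlarged factors are infinite, so this family can be infinite; hence the
      importance of a bound independent of the number of equations.\<close>
    define \<F> where "\<F> = (\<lambda>(G, a) x. G (a(n := x))) ` (E \<times> ?P)"
    have n: "n < k" using Suc by simp
    have "\<exists>q\<in>A n. \<forall>r>0. infinite {x \<in> cube d q r. \<forall>f\<in>\<F>. f x = 0}"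
    proof (rule ccontr)
      assume "\<not> ?thesis"
      then have iso: "\<exists>r>0. finite {x \<in> cube d q r. \<forall>f\<in>\<F>. f x = 0}" if "q \<in> A n" for q using that by blast
      have "card (A n) \<le> (2 * D + 1) ^ d"
      proof (rule card_isolated_zeros_le[of _ _ \<F>])
        show "f a = 0" if f: "f \<in> \<F>" and a: "a \<in> A n" for f a
        proof -
          obtain G b where b: "G \<in> E" "b \<in> ?P" "f = (\<lambda>x. G (b(n := x)))" using f by (auto simp: \<F>_def)
          have "b(n := a) \<in> ?P" using upd[of b "B n" a] b(2) a by simp
          then show ?thesis using V b(1,3) by simp
        qed
      qed (use A[OF n] poly n iso in \<open>auto simp: \<F>_def\<close>)
      then show False using A[OF n] by simp
    qed
    then obtain q where q: "q \<in> A n" "\<And>r. r > 0 \<Longrightarrow> infinite {x \<in> cube d q r. \<forall>f\<in>\<F>. f x = 0}" by blast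
    define W where "W = {x \<in> topspace (Euclidean_space d). \<forall>f\<in>\<F>. f x = 0}"
    have "W \<inter> cube d q r = {x \<in> cube d q r. \<forall>f\<in>\<F>. f x = 0}" for r by (auto simp: W_def cube_def)
    then have W: "infinite (W \<inter> cube d q r)" if "r > 0" for r using q(2)[OF that] by simp
    show ?case
    proof (intro exI[of _ "V(n := W)"] exI[of _ "p(n := q)"] conjI ballI)
      show "\<forall>i<Suc n. (p(n := q)) i \<in> A i \<and> (V(n := W)) i \<subseteq> topspace (Euclidean_space d) \<and>
            (\<forall>r>0. infinite ((V(n := W)) i \<inter> cube d ((p(n := q)) i) r))"
      proof (intro allI impI)
        fix i assume i: "i < Suc n"
        have "W \<subseteq> topspace (Euclidean_space d)" by (auto simp: W_def)
        then show "(p(n := q)) i \<in> A i \<and> (V(n := W)) i \<subseteq> topspace (Euclidean_space d) \<and>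
            (\<forall>r>0. infinite ((V(n := W)) i \<inter> cube d ((p(n := q)) i) r))"
          using p'[rule_format, of i] q(1) W i by (cases "i = n") simp_all
      qed
      fix G a assume G: "G \<in> E" and a: "a \<in> Pi\<^sub>E {..<k} (\<lambda>i. if i < Suc n then (V(n := W)) i else A i)"
      have "(\<lambda>i. if i < Suc n then (V(n := W)) i else A i) = B(n := W)"
        by (rule ext) (auto simp: B_def)
      with a have a: "a \<in> Pi\<^sub>E {..<k} (B(n := W))" by simp
      \<comment> \<open>The entry \<open>a n\<close> is in \<open>W\<close> but perhaps not in
        \<open>A n\<close>. Putting \<open>q\<close> there gives a tuple of the old mixed box, and
        the equation it defines in the \<open>n\<close>-th point belongs to the family defining
        \<open>W\<close>.\<close>
      have "a(n := q) \<in> ?P" using upd[OF a q(1)] .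
      then have mem: "(\<lambda>x. G ((a(n := q))(n := x))) \<in> \<F>" using G unfolding \<F>_def
        by (intro image_eqI[of _ _ "(G, a(n := q))"]) simp_all
      have "a n \<in> W" using PiE_mem[OF a, of n] n by simp
      then have "\<forall>f\<in>\<F>. f (a n) = 0" by (simp add: W_def)
      then have "G ((a(n := q))(n := a n)) = 0" using mem by (rule bspec)
      then show "G a = 0" by simp
    qed
  qed
  from this[OF order_refl] obtain V p where p: "\<forall>i<k. p i \<in> A i \<and> V i \<subseteq> topspace (Euclidean_space d) \<and>
            (\<forall>r>0. infinite (V i \<inter> cube d (p i) r))"
    and V: "\<forall>G\<in>E. \<forall>a\<in>Pi\<^sub>E {..<k} (\<lambda>i. if i < k then V i else A i). G a = 0" by blast
  have "Pi\<^sub>E {..<k} (\<lambda>i. if i < k then V i else A i) = Pi\<^sub>E {..<k} V" by (intro PiE_cong) simp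
  with V have "\<forall>G\<in>E. \<forall>a\<in>Pi\<^sub>E {..<k} V. G a = 0" by simp
  with p show ?thesis by blast
qed

section \<open>Primitive recursive bounds and a Ramsey theorem for boxes\<close>

text \<open>Ignoring lists of the wrong length allows bounds to be rewritten into convenient
  formulas, whereas \<open>primitive_recursive\<close> speaks of one fixed function on all
  lists.\<close>

definition prim_rec_fun :: "nat \<Rightarrow> (nat list \<Rightarrow> nat) \<Rightarrow> bool" where
  "prim_rec_fun n F \<longleftrightarrow> (\<exists>G. primitive_recursive n G \<and> (\<forall>xs. length xs = n \<longrightarrow> G xs = F xs))"

lemma prim_rec_fun_cong:
  assumes "prim_rec_fun n F" "\<And>xs. length xs = n \<Longrightarrow> F xs = G xs"
  shows "prim_rec_fun n G"
  using assms unfolding prim_rec_fun_def by metis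

lemma prim_rec_fun_comp:
  assumes F: "prim_rec_fun (length gs) F" and gs: "\<And>g. g \<in> set gs \<Longrightarrow> prim_rec_fun n g"
  shows "prim_rec_fun n (\<lambda>xs. F (map (\<lambda>g. g xs) gs))"
proof -
  obtain F' where F': "primitive_recursive (length gs) F'" "\<And>xs. length xs = length gs \<Longrightarrow> F' xs = F xs"
    using F unfolding prim_rec_fun_def by blast
  obtain h where h: "\<And>g. g \<in> set gs \<Longrightarrow> primitive_recursive n (h g) \<and> (\<forall>xs. length xs = n \<longrightarrow> h g xs = g xs)"
    using gs unfolding prim_rec_fun_def by metis
  have "primitive_recursive n (\<lambda>xs. F' (map (\<lambda>g. g xs) (map h gs)))"
    by (rule primitive_recursive.comp) (use F' h in auto)
  moreover have "F' (map (\<lambda>g. g xs) (map h gs)) = F (map (\<lambda>g. g xs) gs)" if "length xs = n" for xs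
  proof -
    have "map (\<lambda>g. g xs) (map h gs) = map (\<lambda>g. g xs) gs" using h that by auto
    then show ?thesis using F'(2)[of "map (\<lambda>g. g xs) gs"] by (metis length_map)
  qed
  ultimately show ?thesis unfolding prim_rec_fun_def by blast
qed

lemma prim_rec_fun_proj: "i < n \<Longrightarrow> prim_rec_fun n (\<lambda>xs. xs ! i)"
  unfolding prim_rec_fun_def using primitive_recursive.proj by blast

lemma prim_rec_fun_Suc:
  assumes "prim_rec_fun n F"
  shows "prim_rec_fun n (\<lambda>xs. Suc (F xs))"
proof -
  have "prim_rec_fun (length [F]) (\<lambda>xs. Suc (hd xs))"
    unfolding prim_rec_fun_def using primitive_recursive.succ by auto
  from prim_rec_fun_comp[OF this] assms show ?thesis by simp
qed

lemma prim_rec_fun_const: "prim_rec_fun n (\<lambda>_. c)"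
proof (induction c)
  case 0
  show ?case unfolding prim_rec_fun_def using primitive_recursive.zero by blast
qed (rule prim_rec_fun_Suc)

lemma prim_rec_fun_reindex:
  assumes "prim_rec_fun m F" "\<And>i. i < m \<Longrightarrow> \<sigma> i < n"
  shows "prim_rec_fun n (\<lambda>xs. F (map (\<lambda>i. xs ! \<sigma> i) [0..<m]))"
proof -
  have "prim_rec_fun n (\<lambda>xs. F (map (\<lambda>g. g xs) (map (\<lambda>i xs. xs ! \<sigma> i) [0..<m])))"
    by (rule prim_rec_fun_comp) (use assms in \<open>auto intro: prim_rec_fun_proj\<close>)
  then show ?thesis by (simp add: comp_def)
qed

lemma prim_rec_fun_drop2:
  assumes "prim_rec_fun n F"
  shows "prim_rec_fun (n + 2) (\<lambda>xs. F (drop 2 xs))"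
proof -
  have "prim_rec_fun (n + 2) (\<lambda>xs. F (map (\<lambda>i. xs ! (i + 2)) [0..<n]))"
    by (rule prim_rec_fun_reindex) (use assms in auto)
  then show ?thesis
  proof (rule prim_rec_fun_cong)
    fix xs :: "nat list" assume "length xs = n + 2"
    then have "map (\<lambda>i. xs ! (i + 2)) [0..<n] = drop 2 xs"
      by (intro nth_equalityI) (auto simp: add.commute)
    then show "F (map (\<lambda>i. xs ! (i + 2)) [0..<n]) = F (drop 2 xs)" by simp
  qed
qed

lemma prim_rec_fun_rec:
  assumes a: "prim_rec_fun n a" and f: "prim_rec_fun n f"
    and g: "prim_rec_fun (n + 2) (\<lambda>ys. g (ys ! 0) (ys ! 1) (drop 2 ys))"
  shows "prim_rec_fun n (\<lambda>xs. rec_nat (f xs) (\<lambda>m r. g m r xs) (a xs))"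
proof -
  obtain f' where f': "primitive_recursive n f'" "\<And>xs. length xs = n \<Longrightarrow> f' xs = f xs"
    using f unfolding prim_rec_fun_def by blast
  obtain g' where g': "primitive_recursive (n + 2) g'"
      "\<And>xs. length xs = n + 2 \<Longrightarrow> g' xs = g (xs ! 0) (xs ! 1) (drop 2 xs)"
    using g unfolding prim_rec_fun_def by blast
  \<comment> \<open>The basic scheme recurses on the head of the list with the tail as parameters;
    so it is fed the computed counter followed by the original arguments.\<close>
  let ?gs = "a # map (\<lambda>i xs. xs ! i) [0..<n]"
  let ?F = "\<lambda>xs. rec_nat (f' (tl xs)) (\<lambda>m r. g' (m # r # tl xs)) (hd xs)"
  have "prim_rec_fun n (\<lambda>xs. ?F (map (\<lambda>g. g xs) ?gs))"
  proof (rule prim_rec_fun_comp)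
    show "prim_rec_fun (length ?gs) ?F"
      using primitive_recursive.prec[OF f'(1) g'(1)] unfolding prim_rec_fun_def by auto
  qed (use a in \<open>auto intro: prim_rec_fun_proj\<close>)
  then show ?thesis
  proof (rule prim_rec_fun_cong)
    fix xs :: "nat list" assume xs: "length xs = n"
    have "map (\<lambda>i. xs ! i) [0..<n] = xs" using xs map_nth by blast
    then show "?F (map (\<lambda>g. g xs) ?gs) = rec_nat (f xs) (\<lambda>m r. g m r xs) (a xs)"
      using f'(2)[OF xs] g'(2) xs by (simp add: comp_def)
  qed
qed

lemma prim_rec_fun_add:
  assumes "prim_rec_fun n a" "prim_rec_fun n b"
  shows "prim_rec_fun n (\<lambda>xs. a xs + b xs)"
proof -
  have "prim_rec_fun n (\<lambda>xs. rec_nat (b xs) (\<lambda>m r. Suc r) (a xs))"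
    by (rule prim_rec_fun_rec[OF assms]) (intro prim_rec_fun_Suc prim_rec_fun_proj, simp)
  moreover have "rec_nat y (\<lambda>m r. Suc r) x = x + y" for x y :: nat by (induction x) auto
  ultimately show ?thesis by simp
qed

lemma prim_rec_fun_mult:
  assumes "prim_rec_fun n a" "prim_rec_fun n b"
  shows "prim_rec_fun n (\<lambda>xs. a xs * b xs)"
proof -
  have "prim_rec_fun n (\<lambda>xs. rec_nat 0 (\<lambda>m r. r + b xs) (a xs))"
    by (intro prim_rec_fun_rec[where g = "\<lambda>m r xs. r + b xs"] assms prim_rec_fun_const prim_rec_fun_add
        prim_rec_fun_proj prim_rec_fun_drop2) simp
  moreover have "rec_nat 0 (\<lambda>m r. r + y) x = x * y" for x y :: nat by (induction x) auto
  ultimately show ?thesis by simp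
qed

lemma prim_rec_fun_power:
  assumes "prim_rec_fun n a" "prim_rec_fun n b"
  shows "prim_rec_fun n (\<lambda>xs. a xs ^ b xs)"
proof -
  have "prim_rec_fun n (\<lambda>xs. rec_nat 1 (\<lambda>m r. r * a xs) (b xs))"
    by (intro prim_rec_fun_rec[where g = "\<lambda>m r xs. r * a xs"] assms prim_rec_fun_const prim_rec_fun_mult
        prim_rec_fun_proj prim_rec_fun_drop2) simp
  moreover have "rec_nat 1 (\<lambda>m r. r * x) y = x ^ y" for x y :: nat by (induction y) auto
  ultimately show ?thesis by simp
qed

section \<open>Monochromatic sub-boxes with an explicit bound\<close>

fun box_ramsey_bound :: "nat \<Rightarrow> nat \<Rightarrow> nat \<Rightarrow> nat" where
  "box_ramsey_bound c n 0 = 0"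
| "box_ramsey_bound c n (Suc k) =
    n * c ^ (box_ramsey_bound c n k ^ k) + box_ramsey_bound c n k + 1"

lemma prim_rec_fun_box_ramsey_bound:
  assumes "prim_rec_fun m c" "prim_rec_fun m n" "prim_rec_fun m k"
  shows "prim_rec_fun m (\<lambda>xs. box_ramsey_bound (c xs) (n xs) (k xs))"
proof -
  have "prim_rec_fun m (\<lambda>xs. rec_nat 0 (\<lambda>i r. n xs * c xs ^ (r ^ i) + r + 1) (k xs))"
    by (intro prim_rec_fun_rec[where g = "\<lambda>i r xs. n xs * c xs ^ (r ^ i) + r + 1"] assms
        prim_rec_fun_const prim_rec_fun_mult prim_rec_fun_add prim_rec_fun_power
        prim_rec_fun_proj prim_rec_fun_drop2) simp_all
  moreover have "rec_nat 0 (\<lambda>i r. y * x ^ (r ^ i) + r + 1) z = box_ramsey_bound x y z" for x y z :: nat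
    by (induction z) auto
  ultimately show ?thesis by simp
qed

lemma pigeonhole_fibre:
  assumes "finite A" "finite C" "\<And>x. x \<in> A \<Longrightarrow> g x \<in> C" "n * card C < card A"
  obtains y where "y \<in> C" "n \<le> card {x \<in> A. g x = y}"
proof (rule ccontr)
  assume "\<not> thesis"
  with that have *: "\<forall>y\<in>C. card {x \<in> A. g x = y} \<le> n" by (meson nat_le_linear)
  have "A = (\<Union>y\<in>C. {x \<in> A. g x = y})" using assms(3) by auto
  then have "card A \<le> (\<Sum>y\<in>C. card {x \<in> A. g x = y})"
    using card_UN_le[OF assms(2), of "\<lambda>y. {x \<in> A. g x = y}"] by simp
  also have "\<dots> \<le> card C * n" using sum_bounded_above[of C _ n] * by simp
  finally show False using assms(4) by (simp add: mult.commute)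
qed

text \<open>Cut the first \<open>k\<close> factors down to \<open>M\<close> points each, where
  \<open>M\<close> is the bound for \<open>k\<close>. Each point of the last factor induces one of
  at most \<open>c ^ (M ^ k)\<close> colourings of this smaller box, so more than \<open>n\<close>
  times as many points yield \<open>n\<close> with the same induced colouring, to which induction
  applies. The summand \<open>M\<close> in the bound keeps the first \<open>k\<close> factors large
  enough.\<close>

lemma box_ramsey:
  assumes "finite C" "card C \<le> c"
    and "\<And>a. a \<in> Pi\<^sub>E {..<k} A \<Longrightarrow> col a \<in> C"
    and "\<And>i. i < k \<Longrightarrow> finite (A i) \<and> box_ramsey_bound c n k \<le> card (A i)"
  shows "\<exists>B \<kappa>. (\<forall>i<k. B i \<subseteq> A i \<and> card (B i) = n) \<and> (\<forall>b \<in> Pi\<^sub>E {..<k} B. col b = \<kappa>)"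
  using assms(3,4)
proof (induction k arbitrary: A col)
  case 0
  show ?case by auto
next
  case (Suc k)
  define M where "M = box_ramsey_bound c n k"
  have "\<exists>A'. A' \<subseteq> A i \<and> card A' = M" if "i < k" for i
  proof -
    have "M \<le> card (A i)" using Suc.prems(2)[of i] that by (simp add: M_def)
    then show ?thesis by (meson obtain_subset_with_card_n)
  qed
  then obtain A' where A': "\<And>i. i < k \<Longrightarrow> A' i \<subseteq> A i \<and> card (A' i) = M" by metis
  have finA': "finite (A' i)" if "i < k" for i
    using A'[OF that] Suc.prems(2)[of i] that by (meson finite_subset less_Suc_eq)
  let ?P = "Pi\<^sub>E {..<k} A'"
  have finP: "finite ?P" using finA' by (auto intro: finite_PiE)
  have cardP: "card ?P = M ^ k" using A' by (simp add: card_PiE)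
  have upd: "a(k := x) \<in> Pi\<^sub>E {..<Suc k} A" if "a \<in> ?P" "x \<in> A k" for a x
    using that A' by (fastforce simp: PiE_iff extensional_def less_Suc_eq)
  define g where "g x = (\<lambda>a\<in>?P. col (a(k := x)))" for x
  let ?D = "Pi\<^sub>E ?P (\<lambda>_. C)"
  have finD: "finite ?D" using finP assms(1) by (auto intro: finite_PiE)
  have gD: "g x \<in> ?D" if "x \<in> A k" for x
  proof (rule PiE_I)
    fix a assume "a \<in> ?P"
    then show "g x a \<in> C" using Suc.prems(1)[OF upd[OF _ that]]
      by (simp add: g_def del: fun_upd_apply)
  qed (simp add: g_def)
  have "card ?D = card C ^ (M ^ k)" using finP cardP by (simp add: card_PiE)
  also have "\<dots> \<le> c ^ (M ^ k)" using assms(2) by (rule power_mono) simp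
  finally have "n * card ?D \<le> n * c ^ (M ^ k)" by simp
  also have "\<dots> < card (A k)" using Suc.prems(2)[of k] by (simp add: M_def)
  finally have less: "n * card ?D < card (A k)" .
  have "finite (A k)" using Suc.prems(2)[of k] by simp
  from pigeonhole_fibre[OF this finD gD less] obtain \<psi> where \<psi>: "\<psi> \<in> ?D" "n \<le> card {x \<in> A k. g x = \<psi>}" .
  obtain Bk where Bk: "Bk \<subseteq> {x \<in> A k. g x = \<psi>}" "card Bk = n"
    using \<psi>(2) by (meson obtain_subset_with_card_n)
  have "\<exists>B \<kappa>. (\<forall>i<k. B i \<subseteq> A' i \<and> card (B i) = n) \<and> (\<forall>b \<in> Pi\<^sub>E {..<k} B. \<psi> b = \<kappa>)"
    by (rule Suc.IH) (use \<psi>(1) finA' A' in \<open>auto simp: M_def\<close>)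
  then obtain B \<kappa> where B: "\<And>i. i < k \<Longrightarrow> B i \<subseteq> A' i \<and> card (B i) = n"
    and \<kappa>: "\<And>b. b \<in> Pi\<^sub>E {..<k} B \<Longrightarrow> \<psi> b = \<kappa>" by blast
  show ?case
  proof (intro exI[of _ "B(k := Bk)"] exI[of _ \<kappa>] conjI allI impI ballI)
    fix i assume "i < Suc k"
    then show "(B(k := Bk)) i \<subseteq> A i" "card ((B(k := Bk)) i) = n"
      using B A' Bk by (auto simp: less_Suc_eq) blast
  next
    fix b assume b: "b \<in> Pi\<^sub>E {..<Suc k} (B(k := Bk))"
    \<comment> \<open>Resetting the last entry to \<open>undefined\<close> gives the extensional
      tuple over the first \<open>k\<close> factors.\<close>
    let ?a = "b(k := undefined)"
    have aB: "?a \<in> Pi\<^sub>E {..<k} B"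
      using b by (force simp: PiE_iff extensional_def less_Suc_eq)
    moreover have "Pi\<^sub>E {..<k} B \<subseteq> ?P" using B by (intro PiE_mono) auto
    ultimately have aP: "?a \<in> ?P" by (rule rev_subsetD)
    have "b k \<in> Bk" using b by (force simp: PiE_iff)
    then have "g (b k) = \<psi>" using Bk by auto
    then have "col (?a(k := b k)) = \<psi> ?a" using aP by (metis g_def restrict_apply')
    then show "col b = \<kappa>" using \<kappa>[OF aB] by simp
  qed
qed

section \<open>Semialgebraic predicates\<close>

lemma poly_fun_mpoly_eval:
  assumes "mpoly_vars q \<subseteq> {..<k} \<times> {..<d}" "mpoly_degree q \<le> D"
  shows "poly_fun d D (\<lambda>x. mpoly_eval q (a(i := x)))"
  unfolding mpoly_eval_def
proof (intro poly_fun_sum poly_fun.scale)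
  fix m assume m: "m \<in> Poly_Mapping.keys q"
  have "poly_fun d (Poly_Mapping.lookup m v) (\<lambda>x. (a(i := x)) (fst v) (snd v) ^ Poly_Mapping.lookup m v)"
    if v: "v \<in> Poly_Mapping.keys m" for v
  proof -
    have "snd v < d" using assms(1) m v by (auto simp: mpoly_vars_def)
    then show ?thesis by (cases "fst v = i") (auto intro: poly_fun_coord_power poly_fun_const)
  qed
  then have "poly_fun d (\<Sum>v\<in>Poly_Mapping.keys m. Poly_Mapping.lookup m v)
      (\<lambda>x. \<Prod>v\<in>Poly_Mapping.keys m. (a(i := x)) (fst v) (snd v) ^ Poly_Mapping.lookup m v)"
    by (rule poly_fun_prod)
  moreover have "(\<Sum>v\<in>Poly_Mapping.keys m. Poly_Mapping.lookup m v) \<le> mpoly_degree q"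
    unfolding mpoly_degree_def using m by (intro Max_ge) auto
  ultimately show "poly_fun d D
      (\<lambda>x. \<Prod>v\<in>Poly_Mapping.keys m. (a(i := x)) (fst v) (snd v) ^ Poly_Mapping.lookup m v)"
    using assms(2) by (meson le_trans poly_fun_mono)
qed

section \<open>Stability of nonzero signs under small perturbations\<close>

lemma sgn_mpoly_eval_locally_constant:
  assumes "mpoly_vars q \<subseteq> {..<k} \<times> {..<d}" "mpoly_eval q p \<noteq> 0"
  shows "\<exists>r>0. \<forall>a. (\<forall>i<k. \<forall>j<d. \<bar>a i j - p i j\<bar> \<le> r) \<longrightarrow> sgn (mpoly_eval q a) = sgn (mpoly_eval q p)"
proof (rule ccontr)
  assume "\<not> ?thesis"
  then have "\<exists>a. (\<forall>i<k. \<forall>j<d. \<bar>a i j - p i j\<bar> \<le> 1 / real (Suc n)) \<and>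
      sgn (mpoly_eval q a) \<noteq> sgn (mpoly_eval q p)" for n
    by (metis divide_pos_pos of_nat_0_less_iff zero_less_Suc zero_less_one)
  then obtain a where a: "\<And>n i j. i < k \<Longrightarrow> j < d \<Longrightarrow> \<bar>a n i j - p i j\<bar> \<le> 1 / real (Suc n)"
    and sgn: "\<And>n. sgn (mpoly_eval q (a n)) \<noteq> sgn (mpoly_eval q p)" by metis
  have lim: "(\<lambda>n. a n i j) \<longlonglongrightarrow> p i j" if "i < k" "j < d" for i j
  proof -
    have "(\<lambda>n. a n i j - p i j) \<longlonglongrightarrow> 0"
    proof (rule Lim_null_comparison)
      show "\<forall>\<^sub>F n in sequentially. norm (a n i j - p i j) \<le> 1 / real (Suc n)"
        using a[OF that] by simp
      show "(\<lambda>n. 1 / real (Suc n)) \<longlonglongrightarrow> 0" using LIMSEQ_inverse_real_of_nat by (simp add: inverse_eq_divide)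
    qed
    then show ?thesis by (rule LIM_zero_cancel)
  qed
  have "(\<lambda>n. mpoly_eval q (a n)) \<longlonglongrightarrow> mpoly_eval q p"
    unfolding mpoly_eval_def
  proof (intro tendsto_intros)
    fix m v assume "m \<in> Poly_Mapping.keys q" "v \<in> Poly_Mapping.keys m"
    then have "v \<in> {..<k} \<times> {..<d}" using assms(1) by (auto simp: mpoly_vars_def)
    then show "(\<lambda>n. a n (fst v) (snd v)) \<longlonglongrightarrow> p (fst v) (snd v)" using lim by auto
  qed
  from tendsto_sgn[OF this assms(2)] have "(\<lambda>n. sgn (mpoly_eval q (a n))) \<longlonglongrightarrow> sgn (mpoly_eval q p)" .
  moreover have "0 < (1 :: real)" by simp
  \<comment> \<open>Distinct signs differ by at least 1, so convergence of signs forces equality at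
    some index.\<close>
  ultimately have "\<forall>\<^sub>F n in sequentially. dist (sgn (mpoly_eval q (a n))) (sgn (mpoly_eval q p)) < 1"
    by (rule tendstoD)
  then obtain n where "dist (sgn (mpoly_eval q (a n))) (sgn (mpoly_eval q p)) < 1"
    by (meson eventually_happens sequentially_bot)
  then show False using sgn[of n] assms(2) by (auto simp: sgn_if dist_real_def split: if_splits)
qed

lemma sgn_mpoly_evals_locally_constant:
  assumes "finite P" "\<And>q. q \<in> P \<Longrightarrow> mpoly_vars q \<subseteq> {..<k} \<times> {..<d}"
  shows "\<exists>r>0. \<forall>a. (\<forall>i<k. \<forall>j<d. \<bar>a i j - p i j\<bar> \<le> r) \<longrightarrow>
    (\<forall>q\<in>P. mpoly_eval q p \<noteq> 0 \<longrightarrow> sgn (mpoly_eval q a) = sgn (mpoly_eval q p))"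
  using assms
proof (induction P rule: finite_induct)
  case empty
  show ?case by (intro exI[of _ 1]) simp
next
  case (insert q P)
  then have "\<exists>r>0. \<forall>a. (\<forall>i<k. \<forall>j<d. \<bar>a i j - p i j\<bar> \<le> r) \<longrightarrow>
    (\<forall>q\<in>P. mpoly_eval q p \<noteq> 0 \<longrightarrow> sgn (mpoly_eval q a) = sgn (mpoly_eval q p))" by blast
  then obtain r where r: "r > 0" "\<And>a. \<forall>i<k. \<forall>j<d. \<bar>a i j - p i j\<bar> \<le> r \<Longrightarrow>
    \<forall>q\<in>P. mpoly_eval q p \<noteq> 0 \<longrightarrow> sgn (mpoly_eval q a) = sgn (mpoly_eval q p)" by blast
  have "\<exists>s>0. \<forall>a. (\<forall>i<k. \<forall>j<d. \<bar>a i j - p i j\<bar> \<le> s) \<longrightarrow>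
    mpoly_eval q p \<noteq> 0 \<longrightarrow> sgn (mpoly_eval q a) = sgn (mpoly_eval q p)"
  proof (cases "mpoly_eval q p = 0")
    case True
    then show ?thesis by (intro exI[of _ 1]) simp
  next
    case False
    then show ?thesis using sgn_mpoly_eval_locally_constant[of q k d p] insert.prems by blast
  qed
  then obtain s where s: "s > 0" "\<And>a. \<forall>i<k. \<forall>j<d. \<bar>a i j - p i j\<bar> \<le> s \<Longrightarrow>
    mpoly_eval q p \<noteq> 0 \<longrightarrow> sgn (mpoly_eval q a) = sgn (mpoly_eval q p)" by blast
  show ?case
  proof (intro exI[of _ "min r s"] conjI allI impI)
    show "0 < min r s" using r s by simp
    fix a assume a: "\<forall>i<k. \<forall>j<d. \<bar>a i j - p i j\<bar> \<le> min r s"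
    then have "\<forall>i<k. \<forall>j<d. \<bar>a i j - p i j\<bar> \<le> r" "\<forall>i<k. \<forall>j<d. \<bar>a i j - p i j\<bar> \<le> s" by simp_all
    with r(2) s(2)
    show "\<forall>q\<in>insert q P. mpoly_eval q p \<noteq> 0 \<longrightarrow> sgn (mpoly_eval q a) = sgn (mpoly_eval q p)" by blast
  qed
qed

lemma finite_polys_of: "finite (polys_of \<Phi>)"
  by (induction \<Phi>) auto

lemma card_polys_of_le: "card (polys_of \<Phi>) \<le> formula_length \<Phi>"
proof (induction \<Phi>)
  case (Conj \<Phi> \<Psi>)
  then show ?case using card_Un_le[of "polys_of \<Phi>" "polys_of \<Psi>"] by simp
next
  case (Disj \<Phi> \<Psi>)
  then show ?case using card_Un_le[of "polys_of \<Phi>" "polys_of \<Psi>"] by simp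
qed simp_all

lemma sign_holds_cong: "sgn x = sgn y \<Longrightarrow> sign_holds \<rho> x \<longleftrightarrow> sign_holds \<rho> y" for x y :: real
  by (cases \<rho>) (auto simp: sgn_if split: if_splits)

lemma sat_cong_sgn:
  "(\<And>q. q \<in> polys_of \<Phi> \<Longrightarrow> sgn (mpoly_eval q a) = sgn (mpoly_eval q b)) \<Longrightarrow> sat \<Phi> a \<longleftrightarrow> sat \<Phi> b"
proof (induction \<Phi>)
  case (Atom \<rho> q)
  then show ?case using sign_holds_cong[of "mpoly_eval q a" "mpoly_eval q b" \<rho>] by simp
qed simp_all

text \<open>The common core of both equivalences: polynomials vanishing on the whole box keep
  vanishing, and those nonzero at \<open>p\<close> keep their sign near \<open>p\<close>. Nothing is
  claimed about a polynomial that vanishes at \<open>p\<close> but not on the whole box; each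
  application has to rule out or avoid this case.\<close>

lemma infinite_sets_with_same_signs:
  assumes "sa_predicate d k \<Phi>" "degree_le D \<Phi>"
    and A: "\<And>i. i < k \<Longrightarrow> finite (A i) \<and> A i \<subseteq> topspace (Euclidean_space d) \<and> (2 * D + 1) ^ d < card (A i)"
  obtains X p where "\<And>i. i < k \<Longrightarrow> X i \<subseteq> topspace (Euclidean_space d) \<and> infinite (X i)"
    and "p \<in> Pi\<^sub>E {..<k} A"
    and "\<And>x q. x \<in> Pi\<^sub>E {..<k} X \<Longrightarrow> q \<in> polys_of \<Phi> \<Longrightarrow>
      (\<And>a. a \<in> Pi\<^sub>E {..<k} A \<Longrightarrow> mpoly_eval q a = 0) \<Longrightarrow> mpoly_eval q x = 0"
    and "\<And>x q. x \<in> Pi\<^sub>E {..<k} X \<Longrightarrow> q \<in> polys_of \<Phi> \<Longrightarrow>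
      mpoly_eval q p \<noteq> 0 \<Longrightarrow> sgn (mpoly_eval q x) = sgn (mpoly_eval q p)"
proof -
  define E where "E = mpoly_eval ` {q \<in> polys_of \<Phi>. \<forall>a\<in>Pi\<^sub>E {..<k} A. mpoly_eval q a = 0}"
  have vars: "mpoly_vars q \<subseteq> {..<k} \<times> {..<d}" if "q \<in> polys_of \<Phi>" for q
    using assms(1) that by (simp add: sa_predicate_def)
  have deg: "mpoly_degree q \<le> D" if "q \<in> polys_of \<Phi>" for q
    using assms(2) that by (simp add: degree_le_def)
  have poly: "poly_fun d D (\<lambda>x. G (a(i := x)))" if G: "G \<in> E" for G a i
  proof -
    obtain q where "q \<in> polys_of \<Phi>" "G = mpoly_eval q" using G by (auto simp: E_def)
    then show ?thesis using poly_fun_mpoly_eval[OF vars deg] by simp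
  qed
  have zero: "G a = 0" if "G \<in> E" "a \<in> Pi\<^sub>E {..<k} A" for G a
    using that by (auto simp: E_def)
  have "\<exists>V p. (\<forall>i<k. p i \<in> A i \<and> V i \<subseteq> topspace (Euclidean_space d) \<and>
            (\<forall>r>0. infinite (V i \<inter> cube d (p i) r))) \<and>
          (\<forall>G\<in>E. \<forall>a\<in>Pi\<^sub>E {..<k} V. G a = 0)"
    by (rule vanishing_extends_to_infinite_sets) (fact A, erule poly, erule (1) zero)
  then obtain V p where p: "\<And>i. i < k \<Longrightarrow> p i \<in> A i \<and> V i \<subseteq> topspace (Euclidean_space d) \<and>
            (\<forall>r>0. infinite (V i \<inter> cube d (p i) r))"
    and V: "\<And>G a. G \<in> E \<Longrightarrow> a \<in> Pi\<^sub>E {..<k} V \<Longrightarrow> G a = 0" by blast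
  let ?p = "restrict p {..<k}"
  obtain r where r: "r > 0" "\<And>a. \<forall>i<k. \<forall>j<d. \<bar>a i j - ?p i j\<bar> \<le> r \<Longrightarrow>
    \<forall>q\<in>polys_of \<Phi>. mpoly_eval q ?p \<noteq> 0 \<longrightarrow> sgn (mpoly_eval q a) = sgn (mpoly_eval q ?p)"
    using sgn_mpoly_evals_locally_constant[OF finite_polys_of vars, of \<Phi> ?p] by blast
  \<comment> \<open>The sets stay infinite because \<open>V i\<close> accumulates at
    \<open>p i\<close>, while \<open>r\<close> protects the nonzero signs.\<close>
  define X where "X i = V i \<inter> cube d (p i) r" for i
  show thesis
  proof (rule that)
    show "X i \<subseteq> topspace (Euclidean_space d) \<and> infinite (X i)" if "i < k" for i
      using p[OF that] r(1) by (auto simp: X_def)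
    show "?p \<in> Pi\<^sub>E {..<k} A" using p by auto
  next
    fix x q assume x: "x \<in> Pi\<^sub>E {..<k} X" and q: "q \<in> polys_of \<Phi>"
      and z: "\<And>a. a \<in> Pi\<^sub>E {..<k} A \<Longrightarrow> mpoly_eval q a = 0"
    have "Pi\<^sub>E {..<k} X \<subseteq> Pi\<^sub>E {..<k} V" by (intro PiE_mono) (auto simp: X_def)
    then have "x \<in> Pi\<^sub>E {..<k} V" using x by blast
    moreover have "mpoly_eval q \<in> E" using q z by (auto simp: E_def)
    ultimately show "mpoly_eval q x = 0" using V by blast
  next
    fix x q assume x: "x \<in> Pi\<^sub>E {..<k} X" and q: "q \<in> polys_of \<Phi>" "mpoly_eval q ?p \<noteq> 0"
    have "\<forall>j<d. \<bar>x i j - ?p i j\<bar> \<le> r" if "i < k" for i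
      using PiE_mem[OF x, of i] that by (simp add: X_def cube_def)
    then show "sgn (mpoly_eval q x) = sgn (mpoly_eval q ?p)" using r(2)[of x] q by blast
  qed
qed

section \<open>The two directions of the equivalence\<close>

lemma holds_on_infinite_imp_finite:
  assumes "holds_on_infinite_sets d k \<Phi>"
  shows "holds_on_finite_sets d k N \<Phi>"
proof -
  obtain X where X: "\<And>i. i < k \<Longrightarrow> X i \<subseteq> topspace (Euclidean_space d) \<and> infinite (X i)"
    and sat: "holds_everywhere k \<Phi> X" using assms by (auto simp: holds_on_infinite_sets_def)
  have "\<exists>B. finite B \<and> card B = N \<and> B \<subseteq> X i" if "i < k" for i
    using infinite_arbitrarily_large X[OF that] by blast
  then obtain B where B: "\<And>i. i < k \<Longrightarrow> finite (B i) \<and> card (B i) = N \<and> B i \<subseteq> X i" by metis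
  have sub: "Pi\<^sub>E {..<k} B \<subseteq> Pi\<^sub>E {..<k} X" using B by (intro PiE_mono) auto
  have "holds_everywhere k \<Phi> B"
    unfolding holds_everywhere_def
  proof
    fix a assume "a \<in> Pi\<^sub>E {..<k} B"
    with sub have "a \<in> Pi\<^sub>E {..<k} X" by (rule subsetD)
    then show "sat \<Phi> a" using sat by (simp add: holds_everywhere_def)
  qed
  moreover have "B i \<subseteq> topspace (Euclidean_space d) \<and> finite (B i) \<and> card (B i) = N" if "i < k" for i
    using B[OF that] X[OF that] by blast
  ultimately show ?thesis unfolding holds_on_finite_sets_def by blast
qed

lemma basic_conjunction_finite_imp_infinite:
  assumes "sa_predicate d k \<Phi>" "degree_le D \<Phi>" "basic_conjunction \<Phi>"
    and "holds_on_finite_sets d k ((2 * D + 1) ^ d + 1) \<Phi>"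
  shows "holds_on_infinite_sets d k \<Phi>"
proof -
  obtain A where A: "\<And>i. i < k \<Longrightarrow> A i \<subseteq> topspace (Euclidean_space d) \<and> finite (A i) \<and>
      card (A i) = (2 * D + 1) ^ d + 1"
    and sat: "\<And>a. a \<in> Pi\<^sub>E {..<k} A \<Longrightarrow> sat \<Phi> a"
    using assms(4) unfolding holds_on_finite_sets_def holds_everywhere_def by blast
  obtain X p where X: "\<And>i. i < k \<Longrightarrow> X i \<subseteq> topspace (Euclidean_space d) \<and> infinite (X i)"
    and p: "p \<in> Pi\<^sub>E {..<k} A"
    and zero: "\<And>x q. x \<in> Pi\<^sub>E {..<k} X \<Longrightarrow> q \<in> polys_of \<Phi> \<Longrightarrow>
      (\<And>a. a \<in> Pi\<^sub>E {..<k} A \<Longrightarrow> mpoly_eval q a = 0) \<Longrightarrow> mpoly_eval q x = 0"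
    and sgn: "\<And>x q. x \<in> Pi\<^sub>E {..<k} X \<Longrightarrow> q \<in> polys_of \<Phi> \<Longrightarrow>
      mpoly_eval q p \<noteq> 0 \<Longrightarrow> sgn (mpoly_eval q x) = sgn (mpoly_eval q p)"
    using infinite_sets_with_same_signs[OF assms(1,2), of A] A by auto
  have "sat \<Phi> x" if x: "x \<in> Pi\<^sub>E {..<k} X" for x
    using assms(3) sat zero[OF x] sgn[OF x]
  proof (induction \<Phi>)
    case (Atom \<rho> q)
    show ?case
    proof (cases "\<rho> = EqZ")
      case True
      then show ?thesis using Atom.prems(2) Atom.prems(3)[of q] by simp
    next
      case False
      have "sign_holds \<rho> (mpoly_eval q p)" using Atom.prems(2)[OF p] by simp
      moreover from this have "mpoly_eval q p \<noteq> 0" using Atom.prems(1) False by auto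
      then have "sgn (mpoly_eval q x) = sgn (mpoly_eval q p)" using Atom.prems(4) by simp
      ultimately show ?thesis
        using sign_holds_cong[of "mpoly_eval q x" "mpoly_eval q p" \<rho>] by simp
    qed
  qed simp_all
  with X show ?thesis unfolding holds_on_infinite_sets_def holds_everywhere_def by blast
qed

lemma finite_imp_infinite:
  assumes "sa_predicate d k \<Phi>" "degree_le D \<Phi>"
    and "holds_on_finite_sets d k (box_ramsey_bound (3 ^ formula_length \<Phi>) ((2 * D + 1) ^ d + 1) k) \<Phi>"
  shows "holds_on_infinite_sets d k \<Phi>"
proof -
  let ?n = "(2 * D + 1) ^ d + 1"
  let ?c = "3 ^ formula_length \<Phi> :: nat"
  let ?P = "polys_of \<Phi>"
  obtain A where A: "\<And>i. i < k \<Longrightarrow> A i \<subseteq> topspace (Euclidean_space d) \<and> finite (A i) \<and>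
      card (A i) = box_ramsey_bound ?c ?n k"
    and sat: "\<And>a. a \<in> Pi\<^sub>E {..<k} A \<Longrightarrow> sat \<Phi> a"
    using assms(3) unfolding holds_on_finite_sets_def holds_everywhere_def by blast
  \<comment> \<open>One sign for each polynomial gives at most
    \<open>3 ^ formula_length \<Phi>\<close> colours, because the formula has at most as many
    polynomials as its length.\<close>
  define signs where "signs a = (\<lambda>q\<in>?P. sgn (mpoly_eval q a))" for a
  let ?C = "Pi\<^sub>E ?P (\<lambda>_. {-1, 0, 1 :: real})"
  have finC: "finite ?C" using finite_polys_of by (intro finite_PiE) auto
  have "card ?C = 3 ^ card ?P" by (simp add: card_PiE finite_polys_of numeral_3_eq_3)
  also have "\<dots> \<le> ?c" using card_polys_of_le by (intro power_increasing) auto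
  finally have cardC: "card ?C \<le> ?c" .
  have "\<exists>B \<kappa>. (\<forall>i<k. B i \<subseteq> A i \<and> card (B i) = ?n) \<and> (\<forall>b \<in> Pi\<^sub>E {..<k} B. signs b = \<kappa>)"
  proof (rule box_ramsey[OF finC cardC])
    show "signs a \<in> ?C" for a by (auto simp: signs_def sgn_if)
    show "finite (A i) \<and> box_ramsey_bound ?c ?n k \<le> card (A i)" if "i < k" for i using A[OF that] by simp
  qed
  then obtain B \<kappa> where B: "\<And>i. i < k \<Longrightarrow> B i \<subseteq> A i \<and> card (B i) = ?n"
    and \<kappa>: "\<And>b. b \<in> Pi\<^sub>E {..<k} B \<Longrightarrow> signs b = \<kappa>" by blast
  have B': "finite (B i) \<and> B i \<subseteq> topspace (Euclidean_space d) \<and> (2 * D + 1) ^ d < card (B i)" if "i < k" for i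
    using A[OF that] B[OF that] finite_subset by auto
  obtain X p where X: "\<And>i. i < k \<Longrightarrow> X i \<subseteq> topspace (Euclidean_space d) \<and> infinite (X i)"
    and p: "p \<in> Pi\<^sub>E {..<k} B"
    and zero: "\<And>x q. x \<in> Pi\<^sub>E {..<k} X \<Longrightarrow> q \<in> ?P \<Longrightarrow>
      (\<And>a. a \<in> Pi\<^sub>E {..<k} B \<Longrightarrow> mpoly_eval q a = 0) \<Longrightarrow> mpoly_eval q x = 0"
    and sgn: "\<And>x q. x \<in> Pi\<^sub>E {..<k} X \<Longrightarrow> q \<in> ?P \<Longrightarrow>
      mpoly_eval q p \<noteq> 0 \<Longrightarrow> sgn (mpoly_eval q x) = sgn (mpoly_eval q p)"
    using infinite_sets_with_same_signs[OF assms(1,2), of B] B' by auto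
  have const: "sgn (mpoly_eval q a) = sgn (mpoly_eval q p)" if "q \<in> ?P" "a \<in> Pi\<^sub>E {..<k} B" for q a
    using \<kappa>[OF p] \<kappa>[OF that(2)] that(1) by (metis signs_def restrict_apply')
  have "Pi\<^sub>E {..<k} B \<subseteq> Pi\<^sub>E {..<k} A" using B by (intro PiE_mono) auto
  then have "sat \<Phi> p" using sat p by blast
  have "sat \<Phi> x" if x: "x \<in> Pi\<^sub>E {..<k} X" for x
  proof -
    have "sgn (mpoly_eval q x) = sgn (mpoly_eval q p)" if q: "q \<in> ?P" for q
    proof (cases "mpoly_eval q p = 0")
      case True
      \<comment> \<open>Here monochromaticity enters: a polynomial that vanishes at \<open>p\<close>
        vanishes on the whole box \<open>B\<close>, so all signs at \<open>p\<close> carry over to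
        the infinite sets.\<close>
      then have "mpoly_eval q a = 0" if "a \<in> Pi\<^sub>E {..<k} B" for a
        using const[OF q that] by (simp add: sgn_eq_0_iff)
      then show ?thesis using zero[OF x q] True by simp
    qed (rule sgn[OF x q])
    then show ?thesis using sat_cong_sgn \<open>sat \<Phi> p\<close> by blast
  qed
  with X show ?thesis unfolding holds_on_infinite_sets_def holds_everywhere_def by blast
qed

theorem theorem9:
  shows "(\<exists>N. primitive_recursive 3 N \<and>
           (\<forall>d D k \<Phi>. sa_predicate d k \<Phi> \<and> degree_le D \<Phi> \<and> basic_conjunction \<Phi> \<longrightarrow>
              (holds_on_finite_sets d k (N [d, D, k]) \<Phi> \<longleftrightarrow> holds_on_infinite_sets d k \<Phi>)))
       \<and> (\<exists>N. primitive_recursive 4 N \<and>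
           (\<forall>d D k \<Phi>. sa_predicate d k \<Phi> \<and> degree_le D \<Phi> \<longrightarrow>
              (holds_on_finite_sets d k (N [d, D, k, formula_length \<Phi>]) \<Phi> \<longleftrightarrow>
               holds_on_infinite_sets d k \<Phi>)))"
proof (rule conjI)
  \<comment> \<open>Entries 0 and 1 of the list are \<open>d\<close> and \<open>D\<close>. The arity
    is left open since the same expression serves both bounds, and the first of them does not depend
    on \<open>k\<close>.\<close>
  have bound: "prim_rec_fun n (\<lambda>xs. (2 * xs ! 1 + 1) ^ xs ! 0 + 1)" if "n \<ge> 2" for n
    using that by (intro prim_rec_fun_add prim_rec_fun_power prim_rec_fun_mult prim_rec_fun_const
        prim_rec_fun_proj) simp_all
  obtain N where N: "primitive_recursive 3 N"
    "\<And>xs. length xs = 3 \<Longrightarrow> N xs = (2 * xs ! 1 + 1) ^ xs ! 0 + 1"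
    using bound[of 3] unfolding prim_rec_fun_def by auto
  have "N [d, D, k] = (2 * D + 1) ^ d + 1" for d D k using N(2)[of "[d, D, k]"] by simp
  then show "\<exists>N. primitive_recursive 3 N \<and>
           (\<forall>d D k \<Phi>. sa_predicate d k \<Phi> \<and> degree_le D \<Phi> \<and> basic_conjunction \<Phi> \<longrightarrow>
              (holds_on_finite_sets d k (N [d, D, k]) \<Phi> \<longleftrightarrow> holds_on_infinite_sets d k \<Phi>))"
    using N(1) basic_conjunction_finite_imp_infinite holds_on_infinite_imp_finite by metis
  \<comment> \<open>Entries 2 and 3 are \<open>k\<close> and the formula length; the monochromatic
    box must have the size required for conjunctions.\<close>
  have "prim_rec_fun 4 (\<lambda>xs. box_ramsey_bound (3 ^ xs ! 3) ((2 * xs ! 1 + 1) ^ xs ! 0 + 1) (xs ! 2))"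
    by (intro prim_rec_fun_box_ramsey_bound bound prim_rec_fun_power prim_rec_fun_const
        prim_rec_fun_proj) simp_all
  then obtain M where M: "primitive_recursive 4 M" "\<And>xs. length xs = 4 \<Longrightarrow>
      M xs = box_ramsey_bound (3 ^ xs ! 3) ((2 * xs ! 1 + 1) ^ xs ! 0 + 1) (xs ! 2)"
    unfolding prim_rec_fun_def by blast
  have "M [d, D, k, l] = box_ramsey_bound (3 ^ l) ((2 * D + 1) ^ d + 1) k" for d D k l
    using M(2)[of "[d, D, k, l]"] by simp
  then show "\<exists>N. primitive_recursive 4 N \<and>
           (\<forall>d D k \<Phi>. sa_predicate d k \<Phi> \<and> degree_le D \<Phi> \<longrightarrow>
              (holds_on_finite_sets d k (N [d, D, k, formula_length \<Phi>]) \<Phi> \<longleftrightarrow>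
               holds_on_infinite_sets d k \<Phi>))"
    using M(1) finite_imp_infinite holds_on_infinite_imp_finite by metis
qed

end
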